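(* Let $\mathscr{C}$ be an $\mathbf{Ord}$-enriched category and let $(F,L,R,K)$ be a predistributive lax functorial factorisation system on $\mathscr{C}$. Let $\mathcal{L}_F=\{f \mid f\perp_{\mathrm{lax}} Rf\}$ and $\mathcal{R}_F=\{f\mid Lf\perp_{\mathrm{lax}} f\}$. Then $(\mathcal{L}_F,\mathcal{R}_F)$ is a lax weak factorisation system. Moreover, for any lax functorial weak factorisation system $(\mathcal{L},\mathcal{R})$ with lax functorial factorisation $(F,L,R,K)$, one has $(\mathcal{L},\mathcal{R})=(\mathcal{L}_F,\mathcal{R}_F)$.
   Context: An $\mathbf{Ord}$-enriched category is a category whose hom-sets are partially ordered and whose composition is monotone in each variable. Lax squares: for morphisms $f:A\to B$ and $g:C\to D$, a lax square $(u,v):f\to g$ is a pair $u:A\to C$, $v:B\to D$ with $g\cdot u\le v\cdot f$. $\mathscr{C}^2_{\mathrm{lax}}$ is the category whose objects are the morphisms of $\mathscr{C}$ and whose morphisms are lax squares, composed componentwise. Lax weak orthogonality: $f\perp_{\mathrm{lax}} g$ means that for every lax square $(u,v):f\to g$ there is a morphism $d:\mathrm{cod}(f)\to\mathrm{dom}(g)$ with $u\le d\cdot f$ and $g\cdot d\le v$ (a lax diagonal morphism). A lax weak factorisation system is a pair $(\mathcal{L},\mathcal{R})$ of classes of morphisms such that $\mathcal{R}=\{g\mid f\perp_{\mathrm{lax}}g \text{ for all } f\in\mathcal{L}\}$, $\mathcal{L}=\{f\mid f\perp_{\mathrm{lax}}g\text{ for all }g\in\mathcal{R}\}$, and every morphism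 $f$ of $\mathscr{C}$ can be written $f=r\cdot l$ with $l\in\mathcal{L}$, $r\in\mathcal{R}$. A lax functorial factorisation system $(F,L,R,K)$ is a functor $F:\mathscr{C}^2_{\mathrm{lax}}\to\mathscr{C}^2_{\mathrm{lax}}\times_{\mathscr{C}}\mathscr{C}^2_{\mathrm{lax}}$ which is a section of the composition functor. Explicitly, it assigns to each $f:A\to B$ morphisms $Lf:A\to Kf$ and $Rf:Kf\to B$ with $Rf\cdot Lf=f$, and to each lax square $(u,v):f\to g$ a morphism $K(u,v):Kf\to Kg$ with $Lg\cdot u\le K(u,v)\cdot Lf$ and $Rg\cdot K(u,v)\le v\cdot Rf$, such that $K$ preserves identities and composition of lax squares. It is predistributive if for every morphism $f$ one has $Lf\perp_{\mathrm{lax}}RLf$ and $LRf\perp_{\mathrm{lax}}Rf$ (where $RLf=R(Lf)$, $LRf=L(Rf)$). A lax functorial weak factorisation system with lax functorial factorisation $(F,L,R,K)$ is a lax weak factorisation system $(\mathcal{L},\mathcal{R})$ such that $Lf\in\mathcal{L}$ and $Rf\in\mathcal{R}$ for every morphism $f$. *)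

theory Defs
  imports Main
begin

record ('o, 'm) ord_cat =
  Obj :: "'o set"
  Arr :: "'m set"
  Dom :: "'m \<Rightarrow> 'o"
  Cod :: "'m \<Rightarrow> 'o"
  Ident :: "'o \<Rightarrow> 'm" ("Id\<index>")
  Comp :: "'m \<Rightarrow> 'm \<Rightarrow> 'm" (infixr "\<cdot>\<index>" 70)
  Le :: "'m \<Rightarrow> 'm \<Rightarrow> bool" (infix "\<preceq>\<index>" 50)

definition Hom :: "('o, 'm, 'x) ord_cat_scheme \<Rightarrow> 'o \<Rightarrow> 'o \<Rightarrow> 'm set" where
  "Hom C A B = {f \<in> Arr C. Dom C f = A \<and> Cod C f = B}"

text \<open>
  Composition is written in applicative order: \<open>g \<cdot> f\<close> means first \<open>f\<close>, then \<open>g\<close>.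
  The values of \<open>Comp\<close> on non-composable pairs and of \<open>Le\<close> on non-parallel pairs are
  irrelevant, and nothing is assumed about them.
\<close>

locale ord_category =
  fixes C :: "('o, 'm, 'x) ord_cat_scheme" (structure)
  assumes Dom_in_Obj: "f \<in> Arr C \<Longrightarrow> Dom C f \<in> Obj C"
    and Cod_in_Obj: "f \<in> Arr C \<Longrightarrow> Cod C f \<in> Obj C"
    and Id_in_Hom: "A \<in> Obj C \<Longrightarrow> Id A \<in> Hom C A A"
    and Comp_in_Hom: "f \<in> Hom C A B \<Longrightarrow> g \<in> Hom C B D \<Longrightarrow> g \<cdot> f \<in> Hom C A D"
    and Comp_Id: "f \<in> Hom C A B \<Longrightarrow> f \<cdot> Id A = f"
    and Id_Comp: "f \<in> Hom C A B \<Longrightarrow> Id B \<cdot> f = f"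
    and Comp_assoc: "f \<in> Hom C A B \<Longrightarrow> g \<in> Hom C B D \<Longrightarrow> h \<in> Hom C D E
      \<Longrightarrow> (h \<cdot> g) \<cdot> f = h \<cdot> (g \<cdot> f)"
    and Le_refl: "f \<in> Hom C A B \<Longrightarrow> f \<preceq> f"
    and Le_trans: "f \<in> Hom C A B \<Longrightarrow> g \<in> Hom C A B \<Longrightarrow> h \<in> Hom C A B
      \<Longrightarrow> f \<preceq> g \<Longrightarrow> g \<preceq> h \<Longrightarrow> f \<preceq> h"
    and Le_antisym: "f \<in> Hom C A B \<Longrightarrow> g \<in> Hom C A B \<Longrightarrow> f \<preceq> g \<Longrightarrow> g \<preceq> f \<Longrightarrow> f = g"
    and Comp_mono_right: "f \<in> Hom C A B \<Longrightarrow> f' \<in> Hom C A B \<Longrightarrow> g \<in> Hom C B D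
      \<Longrightarrow> f \<preceq> f' \<Longrightarrow> g \<cdot> f \<preceq> g \<cdot> f'"
    and Comp_mono_left: "f \<in> Hom C A B \<Longrightarrow> g \<in> Hom C B D \<Longrightarrow> g' \<in> Hom C B D
      \<Longrightarrow> g \<preceq> g' \<Longrightarrow> g \<cdot> f \<preceq> g' \<cdot> f"

text \<open>\<open>lax_square C f g u v\<close>: the pair \<open>(u, v)\<close> is a lax square from \<open>f\<close> to \<open>g\<close>.\<close>

definition lax_square ::
    "('o, 'm, 'x) ord_cat_scheme \<Rightarrow> 'm \<Rightarrow> 'm \<Rightarrow> 'm \<Rightarrow> 'm \<Rightarrow> bool" where
  "lax_square C f g u v \<longleftrightarrow>
     f \<in> Arr C \<and> g \<in> Arr C \<and>
     u \<in> Hom C (Dom C f) (Dom C g) \<and> v \<in> Hom C (Cod C f) (Cod C g) \<and>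
     g \<cdot>\<^bsub>C\<^esub> u \<preceq>\<^bsub>C\<^esub> v \<cdot>\<^bsub>C\<^esub> f"

definition lax_orth :: "('o, 'm, 'x) ord_cat_scheme \<Rightarrow> 'm \<Rightarrow> 'm \<Rightarrow> bool" where
  "lax_orth C f g \<longleftrightarrow>
     (\<forall>u v. lax_square C f g u v \<longrightarrow>
        (\<exists>d \<in> Hom C (Cod C f) (Dom C g). u \<preceq>\<^bsub>C\<^esub> d \<cdot>\<^bsub>C\<^esub> f \<and> g \<cdot>\<^bsub>C\<^esub> d \<preceq>\<^bsub>C\<^esub> v))"

definition lax_wfs :: "('o, 'm, 'x) ord_cat_scheme \<Rightarrow> 'm set \<times> 'm set \<Rightarrow> bool" where
  "lax_wfs C = (\<lambda>(\<L>, \<R>).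
     \<R> = {g \<in> Arr C. \<forall>f \<in> \<L>. lax_orth C f g} \<and>
     \<L> = {f \<in> Arr C. \<forall>g \<in> \<R>. lax_orth C f g} \<and>
     (\<forall>f \<in> Arr C. \<exists>l \<in> \<L>. \<exists>r \<in> \<R>. Cod C l = Dom C r \<and> f = r \<cdot>\<^bsub>C\<^esub> l))"

text \<open>
  The data of a lax functorial factorisation: \<open>Lpart F f\<close> and \<open>Rpart F f\<close> are the two
  factors of \<open>f\<close>, and \<open>Kobj F f\<close> is the object they meet at. A pair \<open>(u, v)\<close> can be a
  lax square between several pairs of morphisms, so the action of \<open>K\<close> on lax squares
  carries source and target: \<open>Kmor F f g u v\<close> is the value of \<open>K\<close> at \<open>(u, v)\<close> seen as
  a lax square from \<open>f\<close> to \<open>g\<close>.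
\<close>

record ('o, 'm) fact_data =
  Lpart :: "'m \<Rightarrow> 'm"
  Rpart :: "'m \<Rightarrow> 'm"
  Kobj :: "'m \<Rightarrow> 'o"
  Kmor :: "'m \<Rightarrow> 'm \<Rightarrow> 'm \<Rightarrow> 'm \<Rightarrow> 'm"

text \<open>
  The identity of \<open>f\<close> in the category of lax squares is the pair of identities, and
  composition of lax squares is componentwise. As in the usual notion of functor into a
  category of lax squares, no monotonicity of \<open>K\<close> on lax squares is required.
\<close>

locale lax_functorial_factorisation = ord_category C
  for C :: "('o, 'm, 'x) ord_cat_scheme" (structure) +
  fixes F :: "('o, 'm) fact_data"
  assumes Kobj_in_Obj: "f \<in> Arr C \<Longrightarrow> Kobj F f \<in> Obj C"
    and Lpart_in_Hom: "f \<in> Arr C \<Longrightarrow> Lpart F f \<in> Hom C (Dom C f) (Kobj F f)"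
    and Rpart_in_Hom: "f \<in> Arr C \<Longrightarrow> Rpart F f \<in> Hom C (Kobj F f) (Cod C f)"
    and factorisation: "f \<in> Arr C \<Longrightarrow> Rpart F f \<cdot> Lpart F f = f"
    and Kmor_in_Hom: "lax_square C f g u v
      \<Longrightarrow> Kmor F f g u v \<in> Hom C (Kobj F f) (Kobj F g)"
    and Kmor_Lpart: "lax_square C f g u v
      \<Longrightarrow> Lpart F g \<cdot> u \<preceq> Kmor F f g u v \<cdot> Lpart F f"
    and Kmor_Rpart: "lax_square C f g u v
      \<Longrightarrow> Rpart F g \<cdot> Kmor F f g u v \<preceq> v \<cdot> Rpart F f"
    and Kmor_Id: "f \<in> Arr C
      \<Longrightarrow> Kmor F f f (Id (Dom C f)) (Id (Cod C f)) = Id (Kobj F f)"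
    and Kmor_Comp: "lax_square C f g u v \<Longrightarrow> lax_square C g h u' v'
      \<Longrightarrow> Kmor F f h (u' \<cdot> u) (v' \<cdot> v) = Kmor F g h u' v' \<cdot> Kmor F f g u v"

definition predistributive ::
    "('o, 'm, 'x) ord_cat_scheme \<Rightarrow> ('o, 'm) fact_data \<Rightarrow> bool" where
  "predistributive C F \<longleftrightarrow>
     (\<forall>f \<in> Arr C. lax_orth C (Lpart F f) (Rpart F (Lpart F f)) \<and>
                   lax_orth C (Lpart F (Rpart F f)) (Rpart F f))"

definition left_class ::
    "('o, 'm, 'x) ord_cat_scheme \<Rightarrow> ('o, 'm) fact_data \<Rightarrow> 'm set" where
  "left_class C F = {f \<in> Arr C. lax_orth C f (Rpart F f)}"

definition right_class ::
    "('o, 'm, 'x) ord_cat_scheme \<Rightarrow> ('o, 'm) fact_data \<Rightarrow> 'm set" where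
  "right_class C F = {f \<in> Arr C. lax_orth C (Lpart F f) f}"

definition lax_functorial_wfs ::
    "('o, 'm, 'x) ord_cat_scheme \<Rightarrow> ('o, 'm) fact_data \<Rightarrow> 'm set \<times> 'm set \<Rightarrow> bool" where
  "lax_functorial_wfs C F = (\<lambda>(\<L>, \<R>).
     lax_functorial_factorisation C F \<and> lax_wfs C (\<L>, \<R>) \<and>
     (\<forall>f \<in> Arr C. Lpart F f \<in> \<L> \<and> Rpart F f \<in> \<R>))"

end

(* For f in the left class, the lax square (Lf, 1) from f to Rf yields d with Lf \<le> d f and
   Rf d \<le> 1; for g in the right class, the lax square (1, Rg) from Lg to g yields s with
   1 \<le> s Lg and g s \<le> Rg. For a lax square (u, v) from f to g the composite s K(u, v) d is then
   a lax diagonal, so the two classes are orthogonal. Predistributivity says precisely that Lf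
   and Rf lie in them, so a morphism orthogonal to one class lies in the other. For uniqueness,
   any such pair is contained classwise in these two classes, hence also contains them. *)
theory Submission
  imports Defs
begin

context lax_functorial_factorisation
begin

text \<open>This makes \<open>Rpart F f\<close> split laxly: \<open>d\<close> is a section up to
  inequality that is also laxly compatible with \<open>Lpart F f\<close>.\<close>

lemma left_class_obtain:
  assumes "f \<in> left_class C F"
  obtains d where "d \<in> Hom C (Cod C f) (Kobj F f)" "Lpart F f \<preceq> d \<cdot> f"
    "Rpart F f \<cdot> d \<preceq> Id (Cod C f)"
proof -
  have f: "f \<in> Arr C" and orth: "lax_orth C f (Rpart F f)"
    using assms by (auto simp: left_class_def)
  have fH: "f \<in> Hom C (Dom C f) (Cod C f)" using f by (simp add: Hom_def)
  have R: "Rpart F f \<in> Arr C" "Dom C (Rpart F f) = Kobj F f" "Cod C (Rpart F f) = Cod C f"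
    using Rpart_in_Hom[OF f] by (auto simp: Hom_def)
  \<comment> \<open>Both composites equal \<open>f\<close> by \<open>factorisation\<close>, so the
    square commutes strictly and reflexivity suffices.\<close>
  have "lax_square C f (Rpart F f) (Lpart F f) (Id (Cod C f))"
    using f R Lpart_in_Hom[OF f] Id_in_Hom[OF Cod_in_Obj[OF f]] Le_refl[OF fH]
    by (simp add: lax_square_def factorisation Id_Comp[OF fH])
  then show thesis using orth R that by (auto simp: lax_orth_def)
qed

text \<open>Dual argument: the strictly commuting square now has the identity on its domain side,
  and \<open>s\<close> is a lax retraction of \<open>Lpart F g\<close>.\<close>

lemma right_class_obtain:
  assumes "g \<in> right_class C F"
  obtains s where "s \<in> Hom C (Kobj F g) (Dom C g)" "Id (Dom C g) \<preceq> s \<cdot> Lpart F g"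
    "g \<cdot> s \<preceq> Rpart F g"
proof -
  have g: "g \<in> Arr C" and orth: "lax_orth C (Lpart F g) g"
    using assms by (auto simp: right_class_def)
  have gH: "g \<in> Hom C (Dom C g) (Cod C g)" using g by (simp add: Hom_def)
  have L: "Lpart F g \<in> Arr C" "Dom C (Lpart F g) = Dom C g" "Cod C (Lpart F g) = Kobj F g"
    using Lpart_in_Hom[OF g] by (auto simp: Hom_def)
  have "lax_square C (Lpart F g) g (Id (Dom C g)) (Rpart F g)"
    using g L Rpart_in_Hom[OF g] Id_in_Hom[OF Dom_in_Obj[OF g]] Le_refl[OF gH]
    by (simp add: lax_square_def factorisation Comp_Id[OF gH])
  then show thesis using orth L that by (auto simp: lax_orth_def)
qed

lemma left_class_lax_orth_right_class:
  assumes f: "f \<in> left_class C F" and g: "g \<in> right_class C F"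
  shows "lax_orth C f g"
  unfolding lax_orth_def
proof (intro allI impI)
  fix u v assume sq: "lax_square C f g u v"
  obtain d where d: "d \<in> Hom C (Cod C f) (Kobj F f)" "Lpart F f \<preceq> d \<cdot> f"
    "Rpart F f \<cdot> d \<preceq> Id (Cod C f)"
    using f by (rule left_class_obtain)
  obtain s where s: "s \<in> Hom C (Kobj F g) (Dom C g)" "Id (Dom C g) \<preceq> s \<cdot> Lpart F g"
    "g \<cdot> s \<preceq> Rpart F g"
    using g by (rule right_class_obtain)
  have fA: "f \<in> Arr C" and gA: "g \<in> Arr C"
    and u: "u \<in> Hom C (Dom C f) (Dom C g)" and v: "v \<in> Hom C (Cod C f) (Cod C g)"
    using sq by (auto simp: lax_square_def)
  have fH: "f \<in> Hom C (Dom C f) (Cod C f)" and gH: "g \<in> Hom C (Dom C g) (Cod C g)"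
    using fA gA by (auto simp: Hom_def)
  define k where "k = Kmor F f g u v"
  have k: "k \<in> Hom C (Kobj F f) (Kobj F g)" "Lpart F g \<cdot> u \<preceq> k \<cdot> Lpart F f"
    "Rpart F g \<cdot> k \<preceq> v \<cdot> Rpart F f"
    using sq by (auto simp: k_def Kmor_in_Hom Kmor_Lpart Kmor_Rpart)
  note Lf = Lpart_in_Hom[OF fA] and Rf = Rpart_in_Hom[OF fA]
    and Lg = Lpart_in_Hom[OF gA] and Rg = Rpart_in_Hom[OF gA]
  \<comment> \<open>The order and associativity laws hold only for typed morphisms, so the
    composites in both chains below first get their hom-sets.\<close>
  have kd: "k \<cdot> d \<in> Hom C (Cod C f) (Kobj F g)" using Comp_in_Hom[OF d(1) k(1)] .
  have sk: "s \<cdot> k \<in> Hom C (Kobj F f) (Dom C g)" using Comp_in_Hom[OF k(1) s(1)] .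
  have e: "s \<cdot> (k \<cdot> d) \<in> Hom C (Cod C f) (Dom C g)" using Comp_in_Hom[OF kd s(1)] .
  have df: "d \<cdot> f \<in> Hom C (Dom C f) (Kobj F f)" using Comp_in_Hom[OF fH d(1)] .
  have sLg: "s \<cdot> Lpart F g \<in> Hom C (Dom C g) (Dom C g)" using Comp_in_Hom[OF Lg s(1)] .
  have Lgu: "Lpart F g \<cdot> u \<in> Hom C (Dom C f) (Kobj F g)" using Comp_in_Hom[OF u Lg] .
  have kLf: "k \<cdot> Lpart F f \<in> Hom C (Dom C f) (Kobj F g)" using Comp_in_Hom[OF Lf k(1)] .
  have gs: "g \<cdot> s \<in> Hom C (Kobj F g) (Cod C g)" using Comp_in_Hom[OF s(1) gH] .
  have Rgk: "Rpart F g \<cdot> k \<in> Hom C (Kobj F f) (Cod C g)" using Comp_in_Hom[OF k(1) Rg] .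
  have vRf: "v \<cdot> Rpart F f \<in> Hom C (Kobj F f) (Cod C g)" using Comp_in_Hom[OF Rf v] .
  have Rfd: "Rpart F f \<cdot> d \<in> Hom C (Cod C f) (Cod C f)" using Comp_in_Hom[OF d(1) Rf] .

  have idu: "Id (Dom C g) \<in> Hom C (Dom C g) (Dom C g)" using Id_in_Hom[OF Dom_in_Obj[OF gA]] .
  \<comment> \<open>The chain is u \<le> s Lg u \<le> s k Lf \<le> s k d f, from the first
    inequalities of \<open>s\<close>, \<open>k\<close> and \<open>d\<close> in turn.\<close>
  have "u \<preceq> s \<cdot> (Lpart F g \<cdot> u)"
    using Comp_mono_left[OF u idu sLg s(2)] by (simp add: Id_Comp[OF u] Comp_assoc[OF u Lg s(1)])
  moreover have "s \<cdot> (Lpart F g \<cdot> u) \<preceq> s \<cdot> (k \<cdot> Lpart F f)"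
    using Comp_mono_right[OF Lgu kLf s(1) k(2)] .
  moreover have "s \<cdot> (k \<cdot> Lpart F f) \<preceq> (s \<cdot> (k \<cdot> d)) \<cdot> f"
    using Comp_mono_right[OF Lf df sk d(2)]
    by (simp add: Comp_assoc[OF Lf k(1) s(1)] Comp_assoc[OF df k(1) s(1)]
        Comp_assoc[OF fH kd s(1)] Comp_assoc[OF fH d(1) k(1)])
  ultimately have upper: "u \<preceq> (s \<cdot> (k \<cdot> d)) \<cdot> f"
    using Le_trans u Comp_in_Hom[OF Lgu s(1)] Comp_in_Hom[OF kLf s(1)] Comp_in_Hom[OF fH e]
    by meson

  have idv: "Id (Cod C f) \<in> Hom C (Cod C f) (Cod C f)" using Id_in_Hom[OF Cod_in_Obj[OF fA]] .
  \<comment> \<open>The chain is g s k d \<le> Rg k d \<le> v Rf d \<le> v, from the second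
    inequalities of \<open>s\<close>, \<open>k\<close> and \<open>d\<close> in turn.\<close>
  have "g \<cdot> (s \<cdot> (k \<cdot> d)) \<preceq> (Rpart F g \<cdot> k) \<cdot> d"
    using Comp_mono_left[OF kd gs Rg s(3)]
    by (simp add: Comp_assoc[OF kd s(1) gH] Comp_assoc[OF d(1) k(1) Rg])
  moreover have "(Rpart F g \<cdot> k) \<cdot> d \<preceq> (v \<cdot> Rpart F f) \<cdot> d"
    using Comp_mono_left[OF d(1) Rgk vRf k(3)] .
  moreover have "(v \<cdot> Rpart F f) \<cdot> d \<preceq> v"
    using Comp_mono_right[OF Rfd idv v d(3)]
    by (simp add: Comp_Id[OF v] Comp_assoc[OF d(1) Rf v])
  ultimately have lower: "g \<cdot> (s \<cdot> (k \<cdot> d)) \<preceq> v"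
    using Le_trans v Comp_in_Hom[OF d(1) Rgk] Comp_in_Hom[OF d(1) vRf] Comp_in_Hom[OF e gH]
    by meson

  show "\<exists>d \<in> Hom C (Cod C f) (Dom C g). u \<preceq> d \<cdot> f \<and> g \<cdot> d \<preceq> v"
    using e upper lower by blast
qed

lemma Lpart_in_left_class:
  assumes "predistributive C F" "f \<in> Arr C"
  shows "Lpart F f \<in> left_class C F"
  using assms Lpart_in_Hom[of f] by (auto simp: predistributive_def left_class_def Hom_def)

lemma Rpart_in_right_class:
  assumes "predistributive C F" "f \<in> Arr C"
  shows "Rpart F f \<in> right_class C F"
  using assms Rpart_in_Hom[of f] by (auto simp: predistributive_def right_class_def Hom_def)

lemma lax_wfs_left_right_class:
  assumes "predistributive C F"
  shows "lax_wfs C (left_class C F, right_class C F)"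
proof -
  note LR = Lpart_in_left_class[OF assms] Rpart_in_right_class[OF assms]
  \<comment> \<open>For the inclusion of the orthogonal complement, test \<open>g\<close> against
    the single member \<open>Lpart F g\<close> of the left class: this is the condition defining
    \<open>right_class\<close>. The next equation is dual.\<close>
  have "right_class C F = {g \<in> Arr C. \<forall>f \<in> left_class C F. lax_orth C f g}"
    using LR(1) left_class_lax_orth_right_class by (auto simp: right_class_def)
  moreover have "left_class C F = {f \<in> Arr C. \<forall>g \<in> right_class C F. lax_orth C f g}"
    using LR(2) left_class_lax_orth_right_class by (auto simp: left_class_def)
  \<comment> \<open>The witnesses are \<open>Lpart F f\<close> and \<open>Rpart F f\<close>, which
    meet at \<open>Kobj F f\<close>.\<close>
  moreover have "\<exists>l \<in> left_class C F. \<exists>r \<in> right_class C F. Cod C l = Dom C r \<and> f = r \<cdot> l"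
    if f: "f \<in> Arr C" for f
    using LR[OF f] Lpart_in_Hom[OF f] Rpart_in_Hom[OF f] factorisation[OF f]
    by (metis (mono_tags, lifting) Hom_def mem_Collect_eq)
  ultimately show ?thesis unfolding lax_wfs_def prod.case by (intro conjI ballI)
qed

lemma lax_functorial_wfs_unique:
  assumes "lax_functorial_wfs C F (\<L>, \<R>)"
  shows "\<L> = left_class C F" "\<R> = right_class C F"
proof -
  \<comment> \<open>The equations for \<L> and \<R> refer to each other and would loop as rewrite
    rules; the membership forms are later instantiated at one element.\<close>
  have \<R>: "g \<in> \<R> \<longleftrightarrow> g \<in> Arr C \<and> (\<forall>f \<in> \<L>. lax_orth C f g)" for g
  proof -
    have "\<R> = {g \<in> Arr C. \<forall>f \<in> \<L>. lax_orth C f g}"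
      using assms unfolding lax_functorial_wfs_def lax_wfs_def prod.case by (elim conjE)
    from arg_cong[OF this, of "\<lambda>X. g \<in> X"] show ?thesis by (simp only: mem_Collect_eq)
  qed
  have \<L>: "f \<in> \<L> \<longleftrightarrow> f \<in> Arr C \<and> (\<forall>g \<in> \<R>. lax_orth C f g)" for f
  proof -
    have "\<L> = {f \<in> Arr C. \<forall>g \<in> \<R>. lax_orth C f g}"
      using assms unfolding lax_functorial_wfs_def lax_wfs_def prod.case by (elim conjE)
    from arg_cong[OF this, of "\<lambda>X. f \<in> X"] show ?thesis by (simp only: mem_Collect_eq)
  qed
  have LR: "Lpart F f \<in> \<L>" "Rpart F f \<in> \<R>" if "f \<in> Arr C" for f
    using assms that unfolding lax_functorial_wfs_def prod.case by blast+
  have l: "f \<in> left_class C F" if "f \<in> \<L>" for f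
    using that \<L>[of f] LR(2)[of f] unfolding left_class_def by blast
  have r: "g \<in> right_class C F" if "g \<in> \<R>" for g
    using that \<R>[of g] LR(1)[of g] unfolding right_class_def by blast
  \<comment> \<open>By \<open>r\<close> every member of \<R> lies in \<open>right_class C F\<close>,
    so \<open>f\<close> is orthogonal to all of \<R>, and \<L> contains every such arrow.\<close>
  have "f \<in> \<L>" if "f \<in> left_class C F" for f
    using that \<L>[of f] r left_class_lax_orth_right_class[OF that] by (auto simp: left_class_def)
  then show "\<L> = left_class C F" using l by blast
  have "g \<in> \<R>" if "g \<in> right_class C F" for g
    using that \<R>[of g] l left_class_lax_orth_right_class[OF _ that] by (auto simp: right_class_def)
  then show "\<R> = right_class C F" using r by blast
qed

end

theorem theorem3p4:
  fixes C :: "('o, 'm) ord_cat" and F :: "('o, 'm) fact_data"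
  assumes "ord_category C"
    and "lax_functorial_factorisation C F"
    and "predistributive C F"
  shows "lax_wfs C (left_class C F, right_class C F) \<and>
    (\<forall>\<L> \<R>. lax_functorial_wfs C F (\<L>, \<R>) \<longrightarrow>
       (\<L>, \<R>) = (left_class C F, right_class C F))"
  using lax_functorial_factorisation.lax_wfs_left_right_class[OF assms(2,3)]
    lax_functorial_factorisation.lax_functorial_wfs_unique[OF assms(2)]
  by blast

end
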